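(* Let $X$ be a perfect Polish space, let $\Gamma$ be a countable, finitely generated group, and let $(\mathbb B,\|\cdot\|_{\mathbb B})$ be a separable Banach space. If $T:\Gamma\to\mathrm{Homeo}(X)$ is a topologically transitive action, then there is a bounded, continuous cocycle $h:\Gamma\times X\to\mathbb B$ such that the skew product action $T^{(h)}$ of $\Gamma$ on $X\times\mathbb B$ is topologically transitive.
   Context: An action $T:\Gamma\to\mathrm{Homeo}(X)$ is a group homomorphism $n\mapsto T_n$ into the group of homeomorphisms of $X$. It is topologically transitive if some point has a dense orbit $\{T_nx:n\in\Gamma\}$ (for actions of countable groups on Polish spaces this is equivalent to: for all nonempty open $U,V$ there is $n\in\Gamma$ with $T_nU\cap V\neq\emptyset$). A continuous $T$-cocycle is a function $h:\Gamma\times X\to\mathbb B$ such that $x\mapsto h(n,x)$ is continuous for every $n\in\Gamma$ and $h(nk,x)=h(k,x)+h(n,T_kx)$ for all $n,k\in\Gamma$, $x\in X$. It is bounded if $\sup_{x\in X}\|h(\gamma,x)\|_{\mathbb B}<\infty$ for every $\gamma\in\Gamma$. The skew product action is $T^{(h)}_n(x,z):=(T_nx,\,z+h(n,x))$ for $n\in\Gamma$, $(x,z)\in X\times\mathbb B$. *)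

theory Defs
  imports "HOL-Analysis.Analysis" "HOL-Algebra.Generated_Groups"
begin

definition finitely_generated_group :: "('g, 'm) monoid_scheme \<Rightarrow> bool"
  where "finitely_generated_group G \<longleftrightarrow>
    (\<exists>S. finite S \<and> S \<subseteq> carrier G \<and> generate G S = carrier G)"

definition homeo_group :: "('x::topological_space \<Rightarrow> 'x) monoid"
  where "homeo_group =
    \<lparr>carrier = {f. \<exists>g. homeomorphism UNIV UNIV f g}, mult = (\<circ>), one = id\<rparr>"

lemma group_homeo_group: "group (homeo_group :: ('x::topological_space \<Rightarrow> 'x) monoid)"
proof (rule groupI)
  fix f g :: "'x \<Rightarrow> 'x"
  assume "f \<in> carrier homeo_group" "g \<in> carrier homeo_group"
  then obtain f' g' where "homeomorphism UNIV UNIV f f'" "homeomorphism UNIV UNIV g g'"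
    by (auto simp: homeo_group_def)
  then show "f \<otimes>\<^bsub>homeo_group\<^esub> g \<in> carrier homeo_group"
    by (auto simp: homeo_group_def intro: homeomorphism_compose)
next
  show "\<one>\<^bsub>homeo_group\<^esub> \<in> carrier (homeo_group :: ('x \<Rightarrow> 'x) monoid)"
    by (auto simp: homeo_group_def homeomorphism_def intro!: exI[of _ id])
next
  fix f :: "'x \<Rightarrow> 'x"
  assume "f \<in> carrier homeo_group"
  then obtain f' where f': "homeomorphism UNIV UNIV f f'"
    by (auto simp: homeo_group_def)
  moreover from f' have "homeomorphism UNIV UNIV f' f"
    by (rule homeomorphism_symD)
  moreover from f' have "f' \<circ> f = id"
    by (auto simp: homeomorphism_def)
  ultimately show "\<exists>g\<in>carrier homeo_group. g \<otimes>\<^bsub>homeo_group\<^esub> f = \<one>\<^bsub>homeo_group\<^esub>"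
    by (auto simp: homeo_group_def)
qed (auto simp: homeo_group_def)

definition continuous_action ::
    "('g, 'm) monoid_scheme \<Rightarrow> ('g \<Rightarrow> 'x::topological_space \<Rightarrow> 'x) \<Rightarrow> bool"
  where "continuous_action G T \<longleftrightarrow> group_hom G homeo_group T"

definition topologically_transitive ::
    "('g, 'm) monoid_scheme \<Rightarrow> ('g \<Rightarrow> 'x::topological_space \<Rightarrow> 'x) \<Rightarrow> bool"
  where "topologically_transitive G T \<longleftrightarrow>
    (\<exists>x. closure {T n x | n. n \<in> carrier G} = UNIV)"

definition continuous_cocycle ::
    "('g, 'm) monoid_scheme \<Rightarrow> ('g \<Rightarrow> 'x::topological_space \<Rightarrow> 'x)
      \<Rightarrow> ('g \<Rightarrow> 'x \<Rightarrow> 'b::real_normed_vector) \<Rightarrow> bool"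
  where "continuous_cocycle G T h \<longleftrightarrow>
    (\<forall>n\<in>carrier G. continuous_on UNIV (h n)) \<and>
    (\<forall>n\<in>carrier G. \<forall>k\<in>carrier G. \<forall>x. h (n \<otimes>\<^bsub>G\<^esub> k) x = h k x + h n (T k x))"

text \<open>The bound may depend on the group element; it is uniform only in the point.\<close>

definition bounded_cocycle ::
    "('g, 'm) monoid_scheme \<Rightarrow> ('g \<Rightarrow> 'x \<Rightarrow> 'b::real_normed_vector) \<Rightarrow> bool"
  where "bounded_cocycle G h \<longleftrightarrow>
    (\<forall>n\<in>carrier G. bdd_above (range (\<lambda>x. norm (h n x))))"

definition skew_product ::
    "('g \<Rightarrow> 'x \<Rightarrow> 'x) \<Rightarrow> ('g \<Rightarrow> 'x \<Rightarrow> 'b::real_normed_vector) \<Rightarrow> 'g \<Rightarrow> 'x \<times> 'b \<Rightarrow> 'x \<times> 'b"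
  where "skew_product T h n = (\<lambda>(x, z). (T n x, z + h n x))"

lemma continuous_action_skew_product:
  fixes T :: "'g \<Rightarrow> 'x::topological_space \<Rightarrow> 'x" and h :: "'g \<Rightarrow> 'x \<Rightarrow> 'b::real_normed_vector"
  assumes T: "continuous_action G T" and h: "continuous_cocycle G T h"
  shows "continuous_action G (skew_product T h)"
proof -
  interpret T: group_hom G homeo_group T
    using T by (simp add: continuous_action_def)
  have T_mult: "T (n \<otimes>\<^bsub>G\<^esub> k) x = T n (T k x)"
    if "n \<in> carrier G" "k \<in> carrier G" for n k x
    using T.hom_mult[OF that] by (simp add: homeo_group_def)
  have T_one: "T \<one>\<^bsub>G\<^esub> x = x" for x
    using T.hom_one by (simp add: homeo_group_def)
  have T_cont: "continuous_on UNIV (T n)" if "n \<in> carrier G" for n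
    using T.hom_closed[OF that] by (auto simp: homeo_group_def homeomorphism_def)
  have h_cont: "continuous_on UNIV (h n)" if "n \<in> carrier G" for n
    using h that by (simp add: continuous_cocycle_def)
  have h_mult: "h (n \<otimes>\<^bsub>G\<^esub> k) x = h k x + h n (T k x)"
    if "n \<in> carrier G" "k \<in> carrier G" for n k x
    using h that by (simp add: continuous_cocycle_def)
  have h_one: "h \<one>\<^bsub>G\<^esub> x = 0" for x
    using h_mult[of "\<one>\<^bsub>G\<^esub>" "\<one>\<^bsub>G\<^esub>" x] by (simp add: T_one del: T.hom_one)
  have mult: "skew_product T h (n \<otimes>\<^bsub>G\<^esub> k) = skew_product T h n \<circ> skew_product T h k"
    if "n \<in> carrier G" "k \<in> carrier G" for n k
    using that by (auto simp: skew_product_def T_mult h_mult add.assoc simp del: T.hom_mult)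
  have one: "skew_product T h \<one>\<^bsub>G\<^esub> = id"
    by (auto simp: skew_product_def T_one h_one simp del: T.hom_one)
  have cont: "continuous_on UNIV (skew_product T h n)" if "n \<in> carrier G" for n
    unfolding skew_product_def case_prod_beta
    by (intro continuous_intros continuous_on_compose2[OF T_cont[OF that]]
        continuous_on_compose2[OF h_cont[OF that]]) auto
  have "homeomorphism UNIV UNIV (skew_product T h n) (skew_product T h (inv\<^bsub>G\<^esub> n))"
    if n: "n \<in> carrier G" for n
  proof -
    have "skew_product T h n \<circ> skew_product T h (inv\<^bsub>G\<^esub> n) = id"
      "skew_product T h (inv\<^bsub>G\<^esub> n) \<circ> skew_product T h n = id"
      using n by (simp_all flip: mult add: one)
    then show ?thesis
      using n by (intro homeomorphismI cont) (auto simp: fun_eq_iff)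
  qed
  then have "skew_product T h \<in> hom G homeo_group"
    by (auto simp: hom_def homeo_group_def mult)
  then show ?thesis
    by (simp add: continuous_action_def group_hom_def group_hom_axioms_def group_homeo_group)
qed

end

theory Submission
  imports Defs
begin

text \<open>The cocycle is a uniform limit of coboundaries \<open>F\<^sub>i (T\<^sub>n x) - F\<^sub>i x\<close>. Fix \<open>x\<^sub>0\<close> with dense orbit and
  enumerate pairs \<open>(U\<^sub>i, v\<^sub>i)\<close> of a basic open set of \<open>X\<close> and a vector from a dense set. Step \<open>i\<close>
  perturbs \<open>F\<^sub>i\<close> so that some orbit point \<open>y = T\<^sub>n x\<^sub>0\<close> in \<open>U\<^sub>i\<close> satisfies \<open>F (y) - F (x\<^sub>0) = v\<^sub>i\<close> exactly,
  without changing the values at the orbit points treated earlier. The perturbation is a vector times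
  a bump function that is almost invariant under a given finite part of the group. Such bumps exist
  because \<open>X\<close> is perfect: \<open>y\<close> can be chosen outside any finite set, hence far away, along the orbit, from
  all earlier points, and the bump can be spread out over a large ball of the group.\<close>

section \<open>Almost invariant bump functions for finite families of maps\<close>

lemma continuous_on_Max_image:
  fixes f :: "'i \<Rightarrow> 'a::topological_space \<Rightarrow> 'b::linorder_topology"
  assumes "finite I" "I \<noteq> {}" "\<And>i. i \<in> I \<Longrightarrow> continuous_on A (f i)"
  shows "continuous_on A (\<lambda>x. Max ((\<lambda>i. f i x) ` I))"
  using assms
  by (induction I rule: finite_ne_induct) (auto intro!: continuous_on_max)

lemma bump_function_avoiding_finite:
  fixes y :: "'x::metric_space"
  assumes "finite Q" "y \<notin> Q"
  obtains \<psi> :: "'x \<Rightarrow> real" where "continuous_on UNIV \<psi>" "\<And>x. 0 \<le> \<psi> x" "\<And>x. \<psi> x \<le> 1"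
    "\<psi> y = 1" "\<And>x. x \<in> Q \<Longrightarrow> \<psi> x = 0"
proof -
  obtain r where r: "r > 0" "\<And>x. x \<in> Q \<Longrightarrow> x \<noteq> y \<Longrightarrow> r \<le> dist y x"
    using finite_set_avoid[OF assms(1), of y] by auto
  show ?thesis
  proof (rule that[of "\<lambda>x. max 0 (1 - dist y x / r)"])
    show "continuous_on UNIV (\<lambda>x. max 0 (1 - dist y x / r))"
      using r(1) by (intro continuous_intros) auto
    show "max 0 (1 - dist y x / r) = 0" if "x \<in> Q" for x
    proof -
      have "r \<le> dist y x" using r(2)[OF that] that assms(2) by blast
      then show ?thesis using r(1) by simp
    qed
  qed (use r(1) in auto)
qed

text \<open>The maximum of \<open>\<psi>\<close> over all points reached from \<open>x\<close> by
  words of length exactly \<open>k\<close> in \<open>H\<close>. When \<open>H\<close> contains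
  \<open>id\<close>, it is a maximum over all words of length at most \<open>k\<close>.\<close>

fun spread_max :: "('x \<Rightarrow> 'x) set \<Rightarrow> ('x \<Rightarrow> real) \<Rightarrow> nat \<Rightarrow> 'x \<Rightarrow> real" where
  "spread_max H \<psi> 0 x = \<psi> x"
| "spread_max H \<psi> (Suc k) x = Max ((\<lambda>s. spread_max H \<psi> k (s x)) ` H)"

lemma spread_max_ge:
  assumes "finite H" "s \<in> H"
  shows "spread_max H \<psi> k (s x) \<le> spread_max H \<psi> (Suc k) x"
  using assms by simp

lemma spread_max_le:
  assumes "finite H" "H \<noteq> {}" "\<And>x. \<psi> x \<le> c"
  shows "spread_max H \<psi> k x \<le> c"
  using assms by (induction k arbitrary: x) auto

lemma spread_max_nonneg:
  assumes "finite H" "H \<noteq> {}" "\<And>x. 0 \<le> \<psi> x"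
  shows "0 \<le> spread_max H \<psi> k x"
proof (induction k arbitrary: x)
  case (Suc k)
  obtain s where "s \<in> H" using assms(2) by blast
  then show ?case using Suc[of "s x"] spread_max_ge[OF assms(1), of s \<psi> k x] by linarith
qed (use assms in simp)

lemma continuous_on_spread_max:
  assumes "finite H" "H \<noteq> {}" "\<And>s. s \<in> H \<Longrightarrow> continuous_on UNIV s" "continuous_on UNIV \<psi>"
  shows "continuous_on UNIV (spread_max H \<psi> k)"
proof (induction k)
  case 0
  then show ?case using assms(4) by simp
next
  case (Suc k)
  have "continuous_on UNIV (\<lambda>x. Max ((\<lambda>s. spread_max H \<psi> k (s x)) ` H))"
    by (intro continuous_on_Max_image assms(1,2) continuous_on_compose2[OF Suc] assms(3)) auto
  then show ?case by simp
qed

text \<open>The \<open>k\<close>-fold iterate consists of the points reached from \<open>P\<close>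
  by \<open>k\<close> maps of \<open>H\<close>, and the maximum at \<open>p\<close> inspects
  \<open>\<psi>\<close> at no other points. The recursion peels off the map applied first, so the
  induction has to replace \<open>P\<close> by its image.\<close>

lemma spread_max_eq_0:
  assumes "finite H" "H \<noteq> {}"
    and "\<And>x. x \<in> ((\<lambda>A. \<Union>s\<in>H. s ` A) ^^ k) P \<Longrightarrow> \<psi> x = 0" "p \<in> P"
  shows "spread_max H \<psi> k p = 0"
  using assms(3,4)
proof (induction k arbitrary: P p)
  case (Suc k)
  have "\<psi> x = 0" if "x \<in> ((\<lambda>A. \<Union>s\<in>H. s ` A) ^^ k) (\<Union>s\<in>H. s ` P)" for x
    using Suc.prems(1)[of x] that by (simp only: funpow_Suc_right o_apply)
  then have "spread_max H \<psi> k (s p) = 0" if "s \<in> H" for s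
    using Suc.IH[of "\<Union>s\<in>H. s ` P" "s p"] Suc.prems(2) that by blast
  then have "(\<lambda>s. spread_max H \<psi> k (s p)) ` H = {0}" using assms(2) by auto
  then show ?case by simp
qed simp

text \<open>With \<open>m k\<close> the bump spread over words of length \<open>k\<close>, applying
  a map of \<open>H\<close> shifts the index \<open>k\<close> by at most one. The average of
  \<open>m 0\<close>, ..., \<open>m (N - 1)\<close> therefore changes by at most one boundary term
  divided by \<open>N\<close>.\<close>

lemma almost_invariant_bump:
  fixes H :: "('x::metric_space \<Rightarrow> 'x) set"
  assumes H: "finite H" "id \<in> H" "\<And>s. s \<in> H \<Longrightarrow> continuous_on UNIV s"
    and inv: "\<And>s. s \<in> H \<Longrightarrow> \<exists>s'\<in>H. s' \<circ> s = id"
    and "finite P" and N: "(N::nat) > 0"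
  obtains Q where "finite Q"
    "\<And>y. y \<notin> Q \<Longrightarrow> \<exists>\<phi>. continuous_on UNIV \<phi> \<and> (\<forall>x. 0 \<le> \<phi> x \<and> \<phi> x \<le> 1) \<and> \<phi> y = 1 \<and>
      (\<forall>x\<in>P. \<phi> x = 0) \<and> (\<forall>s\<in>H. \<forall>x. \<bar>\<phi> (s x) - \<phi> x\<bar> \<le> 1 / real N)"
proof -
  \<comment> \<open>The points reachable from \<open>P\<close> in fewer than \<open>N\<close> steps:
    a bump vanishing on them keeps every averaged \<open>m k\<close> zero on
    \<open>P\<close>.\<close>
  define Q where "Q = (\<Union>k<N. ((\<lambda>A. \<Union>s\<in>H. s ` A) ^^ k) P)"
  have "finite (((\<lambda>A. \<Union>s\<in>H. s ` A) ^^ k) P)" for k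
    by (induction k) (use assms in auto)
  then have "finite Q" by (simp add: Q_def)
  have ne: "H \<noteq> {}" using H(2) by blast
  show ?thesis
  proof (rule that[OF \<open>finite Q\<close>])
    fix y assume "y \<notin> Q"
    then obtain \<psi> :: "'x \<Rightarrow> real" where \<psi>: "continuous_on UNIV \<psi>" "\<And>x. 0 \<le> \<psi> x" "\<And>x. \<psi> x \<le> 1"
      "\<psi> y = 1" "\<And>x. x \<in> Q \<Longrightarrow> \<psi> x = 0"
      using bump_function_avoiding_finite[OF \<open>finite Q\<close>] by metis
    define m where "m = spread_max H \<psi>"
    have m0: "0 \<le> m k x" and m1: "m k x \<le> 1" for k x
      using spread_max_nonneg[OF H(1) ne \<psi>(2)] spread_max_le[OF H(1) ne \<psi>(3)] by (auto simp: m_def)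
    have step: "m k (s x) \<le> m (Suc k) x" if "s \<in> H" for s k x
      unfolding m_def by (rule spread_max_ge[OF H(1) that])
    \<comment> \<open>Spreading never lowers the value at \<open>y\<close>, because
      \<open>id\<close> is among the maps and 1 is the upper bound.\<close>
    have my: "m k y = 1" for k
    proof (induction k)
      case (Suc k)
      show ?case using step[OF H(2), of k y] m1[of "Suc k" y] Suc by simp
    qed (use \<psi>(4) in \<open>simp add: m_def\<close>)
    \<comment> \<open>Shifting the index changes the sum only by its end terms
      \<open>m N b - m 0 b\<close>, at most 1 since both lie between 0 and 1.\<close>
    have shift: "(\<Sum>k<N. m k a) \<le> (\<Sum>k<N. m k b) + 1" if "\<And>k. m k a \<le> m (Suc k) b" for a b
    proof -
      have "(\<Sum>k<N. m k a) \<le> (\<Sum>k<N. m (Suc k) b)" by (intro sum_mono that)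
      also have "\<dots> = (\<Sum>k<N. m k b) + (m N b - m 0 b)"
        using sum_lessThan_telescope[of "\<lambda>k. m k b" N] by (simp add: sum_subtractf)
      finally show ?thesis using m1[of N b] m0[of 0 b] by linarith
    qed
    let ?\<phi> = "\<lambda>x. (\<Sum>k<N. m k x) / real N"
    have "\<bar>?\<phi> (s x) - ?\<phi> x\<bar> \<le> 1 / real N" if s: "s \<in> H" for s x
    proof -
      \<comment> \<open>The left inverse gives the reverse comparison
        \<open>m k x \<le> m (Suc k) (s x)\<close>, so that \<open>shift\<close> applies in both
        directions.\<close>
      obtain s' where s': "s' \<in> H" "s' \<circ> s = id" using inv[OF s] by blast
      have "s' (s x) = x" using s'(2) by (simp add: fun_eq_iff)
      then have "m k x \<le> m (Suc k) (s x)" for k using step[OF s'(1), of k "s x"] by simp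
      then have "\<bar>(\<Sum>k<N. m k (s x)) - (\<Sum>k<N. m k x)\<bar> \<le> 1"
        using shift[of x "s x"] shift[of "s x" x] step[OF s] by fastforce
      then show ?thesis using N by (simp add: divide_right_mono flip: diff_divide_distrib)
    qed
    moreover have "continuous_on UNIV ?\<phi>"
      unfolding m_def using N
      by (intro continuous_intros continuous_on_spread_max H ne \<psi>(1)) auto
    moreover have "0 \<le> ?\<phi> x \<and> ?\<phi> x \<le> 1" for x
      using N sum_bounded_above[of "{..<N}" "\<lambda>k. m k x" 1] m1 m0
      by (auto intro!: divide_nonneg_nonneg sum_nonneg)
    moreover have "?\<phi> y = 1" using N by (simp add: my)
    moreover have "?\<phi> x = 0" if "x \<in> P" for x
    proof -
      have "m k x = 0" if "k < N" for k
        unfolding m_def using that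
        by (intro spread_max_eq_0[OF H(1) ne _ \<open>x \<in> P\<close>] \<psi>(5)) (auto simp: Q_def)
      then show ?thesis by simp
    qed
    ultimately show "\<exists>\<phi>. continuous_on UNIV \<phi> \<and> (\<forall>x. 0 \<le> \<phi> x \<and> \<phi> x \<le> 1) \<and> \<phi> y = 1 \<and>
      (\<forall>x\<in>P. \<phi> x = 0) \<and> (\<forall>s\<in>H. \<forall>x. \<bar>\<phi> (s x) - \<phi> x\<bar> \<le> 1 / real N)"
      by (intro exI[of _ ?\<phi>]) blast
  qed
qed

section \<open>Elementary facts about continuous actions\<close>

context
  fixes G :: "('g, 'm) monoid_scheme" and T :: "'g \<Rightarrow> 'x::topological_space \<Rightarrow> 'x"
  assumes T: "continuous_action G T"
begin

lemma continuous_action_group: "group G"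
  using T by (simp add: continuous_action_def group_hom_def)

lemma continuous_action_mult:
  assumes "n \<in> carrier G" "k \<in> carrier G"
  shows "T (n \<otimes>\<^bsub>G\<^esub> k) x = T n (T k x)"
  using group_hom.hom_mult[OF T[unfolded continuous_action_def] assms] by (simp add: homeo_group_def)

lemma continuous_action_one: "T \<one>\<^bsub>G\<^esub> = id"
  using group_hom.hom_one[OF T[unfolded continuous_action_def]] by (simp add: homeo_group_def)

lemma continuous_action_continuous_on:
  assumes "n \<in> carrier G"
  shows "continuous_on UNIV (T n)"
  using group_hom.hom_closed[OF T[unfolded continuous_action_def] assms]
  by (auto simp: homeo_group_def homeomorphism_def)

lemma continuous_action_inv:
  assumes "n \<in> carrier G"
  shows "T (inv\<^bsub>G\<^esub> n) \<circ> T n = id" "T n \<circ> T (inv\<^bsub>G\<^esub> n) = id"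
  using assms continuous_action_group
  by (auto simp: fun_eq_iff continuous_action_one group.l_inv group.r_inv
      simp flip: continuous_action_mult)

end

section \<open>Perturbing a coboundary along the dense orbit, once and then infinitely often\<close>

lemma dense_orbit_avoiding_finite:
  fixes U :: "'x::{perfect_space, t1_space} set"
  assumes "closure D = UNIV" "open U" "U \<noteq> {}" "finite Q"
  obtains y where "y \<in> D" "y \<in> U" "y \<notin> Q"
proof -
  obtain u where "u \<in> U" using assms(3) by blast
  \<comment> \<open>In a perfect T1 space a nonempty open set is infinite, so removing
    \<open>Q\<close> leaves a nonempty open set, which the dense set must meet.\<close>
  then have "infinite U"
    using islimpt_UNIV[of u] assms(2) unfolding islimpt_eq_acc_point by auto
  then have "U - Q \<noteq> {}" using assms(4) by (metis finite_subset Diff_eq_empty_iff)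
  moreover have "open (U - Q)" using assms(2,4) by (simp add: finite_imp_closed open_Diff)
  ultimately have "(U - Q) \<inter> closure D \<noteq> {}" using assms(1) by simp
  then show ?thesis
    using open_Int_closure_eq_empty[OF \<open>open (U - Q)\<close>, of D] that by blast
qed

text \<open>The correction is a bump times the vector \<open>w\<close> missing at the chosen orbit
  point. The norm of \<open>w\<close> is bounded independently of that point, so the bump can be
  made flat enough before the point is chosen.\<close>

lemma coboundary_perturbation:
  fixes T :: "'g \<Rightarrow> 'x::{metric_space, perfect_space} \<Rightarrow> 'x"
    and F :: "'x \<Rightarrow> 'b::real_normed_vector"
  assumes T: "continuous_action G T"
    and dense: "closure {T n x0 | n. n \<in> carrier G} = UNIV"
    and F: "continuous_on UNIV F" "\<And>x. norm (F x) \<le> M"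
    and "finite P" "x0 \<in> P" "finite S" "S \<subseteq> carrier G"
    and "open U" "U \<noteq> {}" "(\<epsilon>::real) > 0"
  obtains g n where "continuous_on UNIV g" "bounded (range g)" "n \<in> carrier G" "T n x0 \<in> U"
    "\<And>x. x \<in> P \<Longrightarrow> g x = 0" "F (T n x0) + g (T n x0) = v + F x0"
    "\<And>s x. s \<in> S \<Longrightarrow> norm (g (T s x) - g x) \<le> \<epsilon>"
proof -
  note inv_closed = group.inv_closed[OF continuous_action_group[OF T]]
  \<comment> \<open>Adding the identity and the inverses supplies the two closure properties that
    the bump construction asks for.\<close>
  define H where "H = T ` (insert \<one>\<^bsub>G\<^esub> (S \<union> (\<lambda>s. inv\<^bsub>G\<^esub> s) ` S))"
  have "finite H" using \<open>finite S\<close> by (simp add: H_def)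
  moreover have "id \<in> H" using continuous_action_one[OF T] by (simp add: H_def)
  moreover have "continuous_on UNIV s" if "s \<in> H" for s
    using that \<open>S \<subseteq> carrier G\<close> continuous_action_continuous_on[OF T] inv_closed
      group.is_monoid[OF continuous_action_group[OF T]]
    by (auto simp: H_def)
  moreover have "\<exists>s'\<in>H. s' \<circ> s = id" if "s \<in> H" for s
  proof -
    consider "s = id" | k where "k \<in> S" "s = T k" | k where "k \<in> S" "s = T (inv\<^bsub>G\<^esub> k)"
      using \<open>s \<in> H\<close> continuous_action_one[OF T] by (auto simp: H_def)
    then show ?thesis
    proof cases
      case 1
      then show ?thesis using \<open>id \<in> H\<close> by auto
    next
      case 2
      then show ?thesis
        using \<open>S \<subseteq> carrier G\<close> continuous_action_inv(1)[OF T, of k]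
        by (intro bexI[of _ "T (inv\<^bsub>G\<^esub> k)"]) (auto simp: H_def)
    next
      case 3
      then show ?thesis
        using \<open>S \<subseteq> carrier G\<close> continuous_action_inv(2)[OF T, of k]
        by (intro bexI[of _ "T k"]) (auto simp: H_def)
    qed
  qed
  \<comment> \<open>\<open>norm v + M + M\<close> bounds \<open>w\<close> for every possible orbit
    point. The \<open>max 0\<close> forces \<open>N\<close> to be positive.\<close>
  moreover obtain N :: nat where N: "N > 0" "(norm v + M + M) / \<epsilon> < real N"
    using reals_Archimedean2[of "max 0 ((norm v + M + M) / \<epsilon>)"] by auto
  ultimately obtain Q where "finite Q" and
    Q: "\<And>y. y \<notin> Q \<Longrightarrow> \<exists>\<phi>. continuous_on UNIV \<phi> \<and> (\<forall>x. 0 \<le> \<phi> x \<and> \<phi> x \<le> 1) \<and> \<phi> y = 1 \<and>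
      (\<forall>x\<in>P. \<phi> x = 0) \<and> (\<forall>s\<in>H. \<forall>x. \<bar>\<phi> (s x) - \<phi> x\<bar> \<le> 1 / real N)"
    using almost_invariant_bump[OF _ _ _ _ \<open>finite P\<close> N(1), of H] by metis
  obtain n where n: "n \<in> carrier G" "T n x0 \<in> U" "T n x0 \<notin> Q"
    using dense_orbit_avoiding_finite[OF dense \<open>open U\<close> \<open>U \<noteq> {}\<close> \<open>finite Q\<close>] by blast
  obtain \<phi> :: "'x \<Rightarrow> real" where \<phi>: "continuous_on UNIV \<phi>" "\<And>x. 0 \<le> \<phi> x" "\<And>x. \<phi> x \<le> 1"
    "\<phi> (T n x0) = 1" "\<And>x. x \<in> P \<Longrightarrow> \<phi> x = 0"
    "\<And>s x. s \<in> H \<Longrightarrow> \<bar>\<phi> (s x) - \<phi> x\<bar> \<le> 1 / real N"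
    using Q[OF n(3)] by metis
  \<comment> \<open>The defect at the new point: there the bump is 1, while at \<open>x0\<close>,
    which lies in \<open>P\<close>, it is 0, so the transfer difference becomes exactly
    \<open>v\<close>.\<close>
  define w where "w = v + F x0 - F (T n x0)"
  have w: "norm w \<le> norm v + M + M"
    unfolding w_def using norm_triangle_ineq4[of "v + F x0" "F (T n x0)"] norm_triangle_ineq[of v "F x0"]
      F(2)[of x0] F(2)[of "T n x0"] by linarith
  show ?thesis
  proof (rule that[of "\<lambda>x. \<phi> x *\<^sub>R w" n])
    show "continuous_on UNIV (\<lambda>x. \<phi> x *\<^sub>R w)" by (intro continuous_intros \<phi>(1))
    have "norm (\<phi> x *\<^sub>R w) \<le> norm w" for x
      using mult_right_mono[OF \<phi>(3)[of x], of "norm w"] \<phi>(2)[of x] by simp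
    then show "bounded (range (\<lambda>x. \<phi> x *\<^sub>R w))" by (auto simp: bounded_iff)
    show "norm (\<phi> (T s x) *\<^sub>R w - \<phi> x *\<^sub>R w) \<le> \<epsilon>" if "s \<in> S" for s x
    proof -
      have "norm (\<phi> (T s x) *\<^sub>R w - \<phi> x *\<^sub>R w) = \<bar>\<phi> (T s x) - \<phi> x\<bar> * norm w"
        by (simp flip: scaleR_diff_left)
      also have "\<dots> \<le> 1 / real N * (norm v + M + M)"
        using \<phi>(6)[of "T s" x] that w by (intro mult_mono) (auto simp: H_def)
      also have "\<dots> \<le> \<epsilon>" using N \<open>\<epsilon> > 0\<close> by (simp add: field_simps)
      finally show ?thesis .
    qed
  qed (use n \<phi>(4,5) in \<open>auto simp: w_def\<close>)
qed

text \<open>Dependent choice iterates the perturbation while carrying a finite set of frozen orbit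
  points. Each target point is frozen once its value is right, so equality persists for all
  \<open>j > i\<close>, while the bounds \<open>\<epsilon> i\<close> control convergence on the
  finite sets \<open>S i\<close>.\<close>

lemma generic_transfer_sequence:
  fixes T :: "'g \<Rightarrow> 'x::{metric_space, perfect_space} \<Rightarrow> 'x"
    and v :: "nat \<Rightarrow> 'b::real_normed_vector" and U :: "nat \<Rightarrow> 'x set"
  assumes T: "continuous_action G T"
    and dense: "closure {T n x0 | n. n \<in> carrier G} = UNIV"
    and U: "\<And>i. open (U i)" "\<And>i. U i \<noteq> {}"
    and S: "\<And>i. finite (S i)" "\<And>i. S i \<subseteq> carrier G"
    and \<epsilon>: "\<And>i. (\<epsilon> i::real) > 0"
  obtains F :: "nat \<Rightarrow> 'x \<Rightarrow> 'b" where "F 0 = (\<lambda>_. 0)"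
    "\<And>i. continuous_on UNIV (F i)" "\<And>i. bounded (range (F i))"
    "\<And>i s x. s \<in> S i \<Longrightarrow> norm ((F (Suc i) (T s x) - F (Suc i) x) - (F i (T s x) - F i x)) \<le> \<epsilon> i"
    "\<And>i. \<exists>n\<in>carrier G. T n x0 \<in> U i \<and> (\<forall>j>i. F j (T n x0) - F j x0 = v i)"
proof -
  \<comment> \<open>A state is a function together with its frozen points. The clause for index 0
    puts the initial value into the invariant, the only place where dependent choice can record
    it.\<close>
  let ?I = "\<lambda>i (F :: 'x \<Rightarrow> 'b, A). (i = (0::nat) \<longrightarrow> F = (\<lambda>_. 0)) \<and>
    continuous_on UNIV F \<and> bounded (range F) \<and> finite A \<and> x0 \<in> A"
  let ?R = "\<lambda>i (F :: 'x \<Rightarrow> 'b, A) (F', A'). A \<subseteq> A' \<and> (\<forall>x\<in>A. F' x = F x) \<and>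
    (\<forall>s\<in>S i. \<forall>x. norm ((F' (T s x) - F' x) - (F (T s x) - F x)) \<le> \<epsilon> i) \<and>
    (\<exists>n\<in>carrier G. T n x0 \<in> U i \<inter> A' \<and> F' (T n x0) - F' x0 = v i)"
  have "\<exists>f. \<forall>i. ?I i (f i) \<and> ?R i (f i) (f (Suc i))"
  proof (rule dependent_nat_choice)
    show "\<exists>st. ?I 0 st" by (rule exI[of _ "(\<lambda>_. 0, {x0})"]) (auto simp: image_constant_conv)
  next
    fix st i assume "?I i st"
    then obtain F A where st: "st = (F, A)"
      and F: "continuous_on UNIV F" "bounded (range F)" and A: "finite A" "x0 \<in> A"
      by (cases st) auto
    from F(2) obtain M where M: "\<And>x. norm (F x) \<le> M" by (auto simp: bounded_iff)
    obtain g n where g: "continuous_on UNIV g" "bounded (range g)" "n \<in> carrier G" "T n x0 \<in> U i"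
      "\<And>x. x \<in> A \<Longrightarrow> g x = 0" "F (T n x0) + g (T n x0) = v i + F x0"
      "\<And>s x. s \<in> S i \<Longrightarrow> norm (g (T s x) - g x) \<le> \<epsilon> i"
      by (rule coboundary_perturbation[OF T dense F(1) M A S[of i] U[of i] \<epsilon>[of i], where v = "v i"]) blast
    have "?I (Suc i) (\<lambda>x. F x + g x, insert (T n x0) A)"
      using A continuous_on_add[OF F(1) g(1)] bounded_plus_comp[OF F(2) g(2)] by simp
    moreover have "?R i st (\<lambda>x. F x + g x, insert (T n x0) A)"
    proof -
      have "norm ((F (T s x) + g (T s x) - (F x + g x)) - (F (T s x) - F x)) \<le> \<epsilon> i"
        if "s \<in> S i" for s x
        using g(7)[OF that, of x] by (simp add: add_diff_add)
      moreover have "F (T n x0) + g (T n x0) - (F x0 + g x0) = v i"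
        using g(5)[OF A(2)] g(6) by simp
      ultimately show ?thesis unfolding st using g(3-5) by auto
    qed
    ultimately show "\<exists>st'. ?I (Suc i) st' \<and> ?R i st st'" by blast
  qed
  then obtain f where f: "\<forall>i. ?I i (f i) \<and> ?R i (f i) (f (Suc i))" by (rule exE)
  define F where "F = (\<lambda>i. fst (f i))"
  define A where "A = (\<lambda>i. snd (f i))"
  have I: "?I i (F i, A i)" for i using f[rule_format, THEN conjunct1, of i]
    by (simp add: F_def case_prod_beta A_def)
  have R: "?R i (F i, A i) (F (Suc i), A (Suc i))" for i
    using f[rule_format, THEN conjunct2, of i] by (simp add: F_def A_def case_prod_beta)
  \<comment> \<open>Frozen points stay frozen, and the values on them never change again.\<close>
  have stable: "F j x = F i x \<and> x \<in> A j" if "i \<le> j" "x \<in> A i" for i j x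
    using that(1)
  proof (induction rule: dec_induct)
    case (step j)
    then show ?case using R[of j] by auto
  qed (use that(2) in simp)
  have "\<exists>n\<in>carrier G. T n x0 \<in> U i \<and> (\<forall>j>i. F j (T n x0) - F j x0 = v i)" for i
  proof -
    obtain n where n: "n \<in> carrier G" "T n x0 \<in> U i" "T n x0 \<in> A (Suc i)"
      "F (Suc i) (T n x0) - F (Suc i) x0 = v i" using R[of i] by auto
    have "x0 \<in> A (Suc i)" using I[of "Suc i"] by simp
    then have "F j (T n x0) - F j x0 = v i" if "j > i" for j
      using stable[of "Suc i" j x0] stable[of "Suc i" j "T n x0"] n that by auto
    then show ?thesis using n by blast
  qed
  then show ?thesis using that[of F] I R by auto
qed

section \<open>Passing to the limit: the cocycle and its transitive skew product\<close>

lemma limit_of_coboundaries: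
  fixes T :: "'g \<Rightarrow> 'x::topological_space \<Rightarrow> 'x" and F :: "nat \<Rightarrow> 'x \<Rightarrow> 'b::real_normed_vector"
  assumes T: "continuous_action G T"
    and F: "\<And>i. continuous_on UNIV (F i)" "\<And>i. bounded (range (F i))"
    and lim: "\<And>n. n \<in> carrier G \<Longrightarrow>
      uniform_limit UNIV (\<lambda>i x. F i (T n x) - F i x) (h n) sequentially"
  shows "continuous_cocycle G T h" "bounded_cocycle G h"
proof -
  note mult_closed = monoid.m_closed[OF group.is_monoid[OF continuous_action_group[OF T]]]
  have ptw: "(\<lambda>i. F i (T n x) - F i x) \<longlonglongrightarrow> h n x" if "n \<in> carrier G" for n x
    using tendsto_uniform_limitI[OF lim[OF that]] by simp
  have "continuous_on UNIV (h n)" if n: "n \<in> carrier G" for n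
    by (rule uniform_limit_theorem[OF _ lim[OF n]])
      (auto intro!: always_eventually continuous_intros F
        continuous_on_compose2[OF F(1) continuous_action_continuous_on[OF T n]])
  \<comment> \<open>Each coboundary satisfies the identity by telescoping through
    \<open>F i (T k x)\<close>, and pointwise limits preserve it.\<close>
  moreover have "h (n \<otimes>\<^bsub>G\<^esub> k) x = h k x + h n (T k x)"
    if n: "n \<in> carrier G" and k: "k \<in> carrier G" for n k x
  proof (rule LIMSEQ_unique)
    show "(\<lambda>i. F i (T (n \<otimes>\<^bsub>G\<^esub> k) x) - F i x) \<longlonglongrightarrow> h (n \<otimes>\<^bsub>G\<^esub> k) x"
      using ptw mult_closed[OF n k] .
    show "(\<lambda>i. F i (T (n \<otimes>\<^bsub>G\<^esub> k) x) - F i x) \<longlonglongrightarrow> h k x + h n (T k x)"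
      using tendsto_add[OF ptw[OF k, of x] ptw[OF n, of "T k x"]]
      by (simp add: continuous_action_mult[OF T n k])
  qed
  ultimately show "continuous_cocycle G T h" by (simp add: continuous_cocycle_def)
  \<comment> \<open>For each \<open>n\<close>, a single index \<open>i\<close> suffices:
    \<open>h n\<close> stays within distance 1 of a coboundary bounded by twice the bound of
    \<open>F i\<close>.\<close>
  have "bdd_above (range (\<lambda>x. norm (h n x)))" if n: "n \<in> carrier G" for n
  proof -
    have "\<forall>\<^sub>F i in sequentially. \<forall>x\<in>UNIV. dist (F i (T n x) - F i x) (h n x) < 1"
      using uniform_limitD[OF lim[OF n]] by simp
    then obtain i where i: "\<And>x. dist (F i (T n x) - F i x) (h n x) < 1"
      by (auto simp: eventually_sequentially)
    obtain M where M: "\<And>x. norm (F i x) \<le> M" using F(2)[of i] by (auto simp: bounded_iff)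
    have "norm (h n x) \<le> M + M + 1" for x
      using i[of x] M[of x] M[of "T n x"] norm_triangle_ineq4[of "F i (T n x)" "F i x"]
        norm_triangle_sub[of "h n x" "F i (T n x) - F i x"]
      by (simp add: dist_norm norm_minus_commute)
    then show ?thesis by (intro bdd_aboveI2)
  qed
  then show "bounded_cocycle G h" by (simp add: bounded_cocycle_def)
qed

theorem theorem1:
  fixes G :: "('g, 'm) monoid_scheme"
    and T :: "'g \<Rightarrow> 'x::{polish_space, perfect_space} \<Rightarrow> 'x"
  assumes "group G"
    and "countable (carrier G)"
    and "finitely_generated_group G"
    and "separable_space (euclidean :: 'b::banach topology)"
    and "continuous_action G T"
    and "topologically_transitive G T"
  shows "\<exists>h :: 'g \<Rightarrow> 'x \<Rightarrow> 'b.
    continuous_cocycle G T h \<and> bounded_cocycle G h \<and>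
    topologically_transitive G (skew_product T h)"
proof -
  note T = \<open>continuous_action G T\<close>
  obtain x0 where x0: "closure {T n x0 | n. n \<in> carrier G} = UNIV"
    using assms(6) by (auto simp: topologically_transitive_def)
  obtain D :: "'b set" where D: "countable D" "closure D = UNIV"
    using assms(4) by (auto simp: separable_space_def)
  obtain B :: "'x set set" where B: "countable B" "topological_basis B"
    using ex_countable_basis by blast
  \<comment> \<open>Countably many targets whose products approximate every point of the product
    space. The empty basic set is removed because no orbit point could hit it.\<close>
  define C where "C = (B - {{}}) \<times> D"
  have C_meets: "\<exists>(O', d)\<in>C. O' \<subseteq> V \<and> d \<in> W"
    if V: "open V" "x \<in> V" and W: "open W" "z \<in> W" for V x W z
  proof -
    obtain O' where "O' \<in> B" "x \<in> O'" "O' \<subseteq> V"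
      using topological_basisE[OF B(2) V] by blast
    moreover obtain d where "d \<in> D" "d \<in> W"
      using open_Int_closure_eq_empty[OF W(1), of D] D(2) W(2) by auto
    ultimately show ?thesis by (auto simp: C_def)
  qed
  have "C \<noteq> {}" using C_meets[of UNIV undefined UNIV undefined] by auto
  have "countable C" using B(1) D(1) by (simp add: C_def)
  define p where "p = from_nat_into C"
  have p: "range p = C"
    using \<open>C \<noteq> {}\<close> \<open>countable C\<close> by (simp add: p_def range_from_nat_into)
  have U: "open (fst (p i))" "fst (p i) \<noteq> {}" for i
    using rangeI[of p i] topological_basis_open[OF B(2)] by (auto simp: p C_def mem_Times_iff)
  \<comment> \<open>Finite sets increasing to the whole group: each fixed element is controlled at
    all but finitely many stages.\<close>
  define S where "S = (\<lambda>i. {n \<in> carrier G. to_nat_on (carrier G) n \<le> i})"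
  have S: "finite (S i)" "S i \<subseteq> carrier G" for i
  proof -
    have "finite (to_nat_on (carrier G) ` S i)"
      by (rule finite_subset[of _ "{..i}"]) (auto simp: S_def)
    moreover have "inj_on (to_nat_on (carrier G)) (S i)"
      by (rule inj_on_subset[OF inj_on_to_nat_on[OF assms(2)]]) (auto simp: S_def)
    ultimately show "finite (S i)" by (rule finite_imageD)
  qed (auto simp: S_def)
  have pos: "0 < (1 / 2 :: real) ^ i" for i by simp
  obtain F :: "nat \<Rightarrow> 'x \<Rightarrow> 'b" where F0: "F 0 = (\<lambda>_. 0)"
    and F: "\<And>i. continuous_on UNIV (F i)" "\<And>i. bounded (range (F i))"
    and small: "\<And>i s x. s \<in> S i \<Longrightarrow>
      norm ((F (Suc i) (T s x) - F (Suc i) x) - (F i (T s x) - F i x)) \<le> (1 / 2) ^ i"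
    and hit: "\<And>i. \<exists>n\<in>carrier G. T n x0 \<in> fst (p i) \<and> (\<forall>j>i. F j (T n x0) - F j x0 = snd (p i))"
    by (rule generic_transfer_sequence[where U = "\<lambda>i. fst (p i)" and v = "\<lambda>i. snd (p i)"
          and S = S and \<epsilon> = "\<lambda>i. (1 / 2) ^ i", OF T x0 U S pos]) (rule that)
  define c where "c = (\<lambda>n i x. F i (T n x) - F i x)"
  \<comment> \<open>The limit of the coboundaries, written as the series of their increments so that
    the Weierstrass M-test applies.\<close>
  define h where "h = (\<lambda>n x. \<Sum>i. c n (Suc i) x - c n i x)"
  have lim: "uniform_limit UNIV (\<lambda>i x. F i (T n x) - F i x) (h n) sequentially"
    if n: "n \<in> carrier G" for n
  proof -
    \<comment> \<open>The geometric bound for \<open>n\<close> starts only once \<open>n\<close>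
      belongs to \<open>S i\<close>, so the eventual form of the test is used.\<close>
    have "\<forall>\<^sub>F i in sequentially. \<forall>x\<in>UNIV. norm (c n (Suc i) x - c n i x) \<le> (1 / 2) ^ i"
      unfolding eventually_sequentially
      by (rule exI[of _ "to_nat_on (carrier G) n"]) (use n small in \<open>auto simp: S_def c_def\<close>)
    then have "uniform_limit UNIV (\<lambda>i x. \<Sum>j<i. c n (Suc j) x - c n j x) (h n) sequentially"
      unfolding h_def by (rule Weierstrass_m_test_ev) (simp add: summable_geometric)
    \<comment> \<open>The partial sums recover the coboundary itself because \<open>F 0\<close> is
      zero.\<close>
    moreover have "(\<Sum>j<i. c n (Suc j) x - c n j x) = F i (T n x) - F i x" for i x
      using sum_lessThan_telescope[of "\<lambda>j. c n j x" i] by (simp add: c_def F0)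
    ultimately show ?thesis by simp
  qed
  \<comment> \<open>The orbit of \<open>(x0, 0)\<close> consists of the points
    \<open>(T n x0, h n x0)\<close>, so density amounts to hitting targets from \<open>C\<close>
    inside every open box.\<close>
  have "topologically_transitive G (skew_product T h)"
    unfolding topologically_transitive_def
  proof (rule exI[of _ "(x0, 0)"], rule equalityI)
    show "UNIV \<subseteq> closure {skew_product T h n (x0, 0) |n. n \<in> carrier G}" (is "_ \<subseteq> closure ?O")
    proof
      fix q :: "'x \<times> 'b"
      show "q \<in> closure ?O"
        unfolding closure_iff_nhds_not_empty
      proof (intro allI impI)
        fix A W assume "W \<subseteq> A" "open W" "q \<in> W"
        obtain V1 V2 where "open V1" "open V2" "q \<in> V1 \<times> V2" "V1 \<times> V2 \<subseteq> W"
          using open_prod_elim[OF \<open>open W\<close> \<open>q \<in> W\<close>] by blast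
        then have V: "open V1" "open V2" "fst q \<in> V1" "snd q \<in> V2" "V1 \<times> V2 \<subseteq> A"
          using \<open>W \<subseteq> A\<close> by auto
        obtain O' d where O': "(O', d) \<in> C" "O' \<subseteq> V1" "d \<in> V2"
          using C_meets[OF V(1,3,2,4)] by auto
        then obtain i where i: "p i = (O', d)" using p by (metis rangeE)
        obtain n where n: "n \<in> carrier G" "T n x0 \<in> O'" "\<And>j. j > i \<Longrightarrow> F j (T n x0) - F j x0 = d"
          using hit[of i] i by auto
        have "(\<lambda>j. F j (T n x0) - F j x0) \<longlonglongrightarrow> h n x0"
          using tendsto_uniform_limitI[OF lim[OF n(1)]] by simp
        \<comment> \<open>After stage \<open>i\<close> the sequence is constant, so passing to the
          limit loses nothing and \<open>h n x0\<close> is exactly \<open>d\<close>.\<close>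
        moreover have "(\<lambda>j. F j (T n x0) - F j x0) \<longlonglongrightarrow> d"
          by (rule tendsto_eventually)
            (use n(3) in \<open>auto simp: eventually_sequentially Suc_le_eq intro!: exI[of _ "Suc i"]\<close>)
        ultimately have "h n x0 = d" by (rule LIMSEQ_unique)
        then have "skew_product T h n (x0, 0) \<in> A"
          using V(5) O' n(2) by (auto simp: skew_product_def)
        then show "?O \<inter> A \<noteq> {}" using n(1) by blast
      qed
    qed
  qed simp
  then show ?thesis
    by (intro exI[of _ h] conjI limit_of_coboundaries[OF T F lim])
qed

end
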